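(* For $r\ge 2$, as formal power series in $t$, \[\sum_{n\ge 0}V_n^{(r)}(x,y)\frac{t^n}{n!}=(1-t^r)^{\frac{x-y}{r}}(1-t)^{-x}.\]
   Context: Fix an integer $r\ge 2$ and indeterminates $x,y$. For $n\ge 1$ let $A_n^{(r)}(x,y)=(a_{i,j})_{1\le i,j\le n}$ be the $n\times n$ matrix with $a_{i,i+1}=-i$ for $1\le i\le n-1$; $a_{i,j}=x$ whenever $0\le i-j\le r-2$; $a_{i,i-r+1}=y+i-r$ for $r\le i\le n$; and all other entries $0$. Define $V_0^{(r)}(x,y)=1$ and $V_n^{(r)}(x,y)=\det A_n^{(r)}(x,y)$ for $n\ge 1$. Powers $(1-u)^{a}$ are understood as binomial series $\sum_k\binom{a}{k}(-u)^k$. *)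

theory Defs
  imports
    "HOL-Computational_Algebra.Formal_Power_Series"
    "Jordan_Normal_Form.Determinant"
begin

(* Rows and columns are numbered from 1 here. Subtractions of indices are written
   additively: "i + 2 \<le> j + r" is i - j \<le> r - 2, and "i + 1 = j + r" is
   j = i - r + 1 (which for j \<ge> 1 forces r \<le> i). The cases are disjoint when r \<ge> 2. *)
definition A_entry :: "nat \<Rightarrow> 'a::comm_ring_1 \<Rightarrow> 'a \<Rightarrow> nat \<Rightarrow> nat \<Rightarrow> 'a" where
  "A_entry r x y i j =
    (if j = i + 1 then - of_nat i
     else if j \<le> i \<and> i + 2 \<le> j + r then x
     else if i + 1 = j + r then y + of_nat i - of_nat r
     else 0)"

(* The library's matrices are indexed from 0, hence the shift by Suc. *)
definition A_mat :: "nat \<Rightarrow> 'a::comm_ring_1 \<Rightarrow> 'a \<Rightarrow> nat \<Rightarrow> 'a mat" where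
  "A_mat r x y n = mat n n (\<lambda>(i, j). A_entry r x y (Suc i) (Suc j))"

(* x and y may be any ring elements; the indeterminates themselves are the generators of
   Q(x, y), for instance realised as the type rat poly poly fract. *)
definition V :: "nat \<Rightarrow> 'a::comm_ring_1 \<Rightarrow> 'a \<Rightarrow> nat \<Rightarrow> 'a" where
  "V r x y n = (if n = 0 then 1 else det (A_mat r x y n))"

(* (1 - u)^a as the binomial series in -u; meaningful for u with zero constant term. *)
definition one_minus_power :: "'a::field_char_0 fps \<Rightarrow> 'a \<Rightarrow> 'a fps" where
  "one_minus_power u a = fps_compose (fps_binomial a) (- u)"

end

theory Submission
  imports Defs
begin

no_notation vec_index (infixl "$" 100)
unbundle fps_syntax

text \<open>Expanding a lower Hessenberg determinant along its last row turns the entries of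
  \<open>A\<close> into a linear recurrence for \<open>v\<^sub>n = V\<^sub>n / n!\<close>, because the superdiagonal entries
  \<open>-1, -2, \<dots>\<close> contribute exactly the quotients of factorials. The generating function \<open>f\<close>
  therefore satisfies
  \<open>(1 - t\<^sup>r) f' = (x (1 + t + \<dots> + t\<^sup>r\<^sup>-\<^sup>2) + y t\<^sup>r\<^sup>-\<^sup>1) f\<close>.
  The product on the right-hand side satisfies this equation multiplied by \<open>1 - t\<close>, and both
  series have constant term 1.\<close>

text \<open>Deleting column \<open>j\<close> leaves a block lower triangular matrix: the first
  \<open>j\<close> rows have only zeros from column \<open>j\<close> on, and in the remaining rows
  the shift by one moves the superdiagonal onto the diagonal of the triangular block
  \<open>L\<close>. This is the minor met when expanding along the last row.\<close>

lemma det_hessenberg_minor: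
  fixes f :: "nat \<Rightarrow> nat \<Rightarrow> 'a::idom"
  assumes zero: "\<And>i k. i + 1 < k \<Longrightarrow> f i k = 0" and "j \<le> n"
  shows "det (mat n n (\<lambda>(i, k). f i (if k < j then k else Suc k))) =
    det (mat j j (\<lambda>(i, k). f i k)) * (\<Prod>i = j..<n. f i (Suc i))"
proof -
  define L where "L = mat (n - j) (n - j) (\<lambda>(i, k). f (i + j) (Suc (k + j)))"
  define B where "B = mat (n - j) j (\<lambda>(i, k). f (i + j) k)"
  have "mat n n (\<lambda>(i, k). f i (if k < j then k else Suc k)) =
      four_block_mat (mat j j (\<lambda>(i, k). f i k)) (0\<^sub>m j (n - j)) B L"
    using \<open>j \<le> n\<close> by (intro eq_matI) (auto simp: L_def B_def zero)
  moreover have "det (four_block_mat (mat j j (\<lambda>(i, k). f i k)) (0\<^sub>m j (n - j)) B L) =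
      det (mat j j (\<lambda>(i, k). f i k)) * det L"
    by (rule det_four_block_mat_upper_right_zero) (auto simp: L_def B_def)
  moreover have "det L = prod_list (diag_mat L)"
    by (rule det_lower_triangular[of "n - j"]) (auto simp: L_def zero)
  moreover have "prod_list (diag_mat L) = (\<Prod>i = 0..<n - j. f (i + j) (Suc (i + j)))"
    by (simp add: prod_list_diag_prod L_def)
  moreover have "\<dots> = (\<Prod>i = j..<n. f i (Suc i))"
    using prod.shift_bounds_nat_ivl[of "\<lambda>i. f i (Suc i)" 0 j "n - j"] \<open>j \<le> n\<close> by simp
  ultimately show ?thesis by simp
qed

lemma det_hessenberg_Suc:
  fixes f :: "nat \<Rightarrow> nat \<Rightarrow> 'a::idom"
  assumes zero: "\<And>i k. i + 1 < k \<Longrightarrow> f i k = 0"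
  shows "det (mat (Suc n) (Suc n) (\<lambda>(i, k). f i k)) =
    (\<Sum>j\<le>n. f n j * (\<Prod>i = j..<n. - f i (Suc i)) * det (mat j j (\<lambda>(i, k). f i k)))"
    (is "det ?A = _")
proof -
  have "det ?A = (\<Sum>j<Suc n. ?A $$ (n, j) * cofactor ?A n j)"
    by (rule laplace_expansion_row) auto
  also have "\<dots> = (\<Sum>j\<le>n. f n j * (\<Prod>i = j..<n. - f i (Suc i)) * det (mat j j (\<lambda>(i, k). f i k)))"
    unfolding lessThan_Suc_atMost
  proof (intro sum.cong refl)
    fix j assume "j \<in> {..n}"
    then have j: "j \<le> n" by simp
    have "mat_delete ?A n j = mat n n (\<lambda>(i, k). f i (if k < j then k else Suc k))"
      by (rule eq_matI) (auto simp: mat_delete_def)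
    moreover have "(-1 :: 'a) ^ (n + j) * (\<Prod>i = j..<n. f i (Suc i)) = (\<Prod>i = j..<n. - f i (Suc i))"
    proof -
      \<comment> \<open>The cofactor sign has the parity of \<open>n - j\<close>, the number of
        superdiagonal factors, so each factor absorbs one minus sign.\<close>
      have "n + j = (n - j) + 2 * j" using j by simp
      then have "(-1 :: 'a) ^ (n + j) = (-1) ^ (n - j)"
        by (simp only: power_add power_mult) simp
      moreover have "(\<Prod>i = j..<n. - f i (Suc i)) = (-1) ^ (n - j) * (\<Prod>i = j..<n. f i (Suc i))"
        using prod.distrib[of "\<lambda>_. -1" "\<lambda>i. f i (Suc i)" "{j..<n}"] by simp
      ultimately show ?thesis by simp
    qed
    ultimately show "?A $$ (n, j) * cofactor ?A n j =
        f n j * (\<Prod>i = j..<n. - f i (Suc i)) * det (mat j j (\<lambda>(i, k). f i k))"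
      using j by (simp add: cofactor_def det_hessenberg_minor[of f, OF zero j] mult_ac)
  qed
  finally show ?thesis .
qed

lemma V_recurrence:
  fixes x y :: "'a::field_char_0"
  shows "of_nat (Suc n) * (V r x y (Suc n) / fact (Suc n)) =
    (\<Sum>j\<le>n. A_entry r x y (Suc n) (Suc j) * (V r x y j / fact j))"
proof -
  have V_eq: "V r x y m = det (mat m m (\<lambda>(i, k). A_entry r x y (Suc i) (Suc k)))" for m
    by (cases "m = 0") (auto simp: V_def A_mat_def det_dim_zero)
  \<comment> \<open>With indices from 0, the negated superdiagonal entry in row \<open>i\<close> is
    \<open>Suc i\<close>, so the product runs over j+1, ..., n.\<close>
  have prod: "(\<Prod>i = j..<n. of_nat (Suc i)) = (fact n / fact j :: 'a)" if "j \<le> n" for j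
    using that by (induction n rule: dec_induct) (simp_all add: field_simps)
  have "V r x y (Suc n) =
      (\<Sum>j\<le>n. A_entry r x y (Suc n) (Suc j) *
        (\<Prod>i = j..<n. - A_entry r x y (Suc i) (Suc (Suc i))) * V r x y j)"
    unfolding V_eq by (rule det_hessenberg_Suc) (auto simp: A_entry_def)
  also have "\<dots> = (\<Sum>j\<le>n. A_entry r x y (Suc n) (Suc j) * (fact n / fact j) * V r x y j)"
    by (intro sum.cong refl) (simp add: A_entry_def prod del: of_nat_Suc)
  finally show ?thesis
    by (simp add: sum_distrib_left field_simps del: of_nat_Suc)
qed

lemma V_egf_ODE:
  fixes x y :: "'a::field_char_0"
  assumes "r \<ge> 2"
  defines "f \<equiv> Abs_fps (\<lambda>n. V r x y n / fact n)"
  shows "(1 - fps_X ^ r) * fps_deriv f =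
    (fps_const x * (\<Sum>k<r - 1. fps_X ^ k) + fps_const y * fps_X ^ (r - 1)) * f"
proof -
  define C where "C = fps_const x * (\<Sum>k<r - 1. fps_X ^ k) + fps_const y * fps_X ^ (r - 1)"
  have C_nth: "C $ k = (if k + 2 \<le> r then x else if k + 1 = r then y else 0)" for k
  proof -
    have "(\<Sum>i<r - 1. fps_X ^ i) $ k = (if k < r - 1 then 1 else 0 :: 'a)"
      by (simp add: fps_sum_nth fps_X_power_nth)
    then show ?thesis
      using assms(1) by (auto simp: C_def fps_X_power_nth)
  qed
  have "fps_deriv f $ n = (C * f + fps_X ^ r * fps_deriv f) $ n" for n
  proof -
    \<comment> \<open>Along each diagonal the entries are constant, except on the lowest band, where
      y + (n+1) - r = y + j. The constant part gives the convolution with \<open>C\<close>; the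
      excess j differentiates \<open>f\<close> and produces the term t^r f'.\<close>
    have entry: "A_entry r x y (Suc n) (Suc j) =
        C $ (n - j) + (if n + 1 = j + r then of_nat j else 0)" if "j \<le> n" for j
    proof -
      have "1 + (of_nat n :: 'a) - of_nat r = of_nat j" if "n + 1 = j + r"
        using arg_cong[OF that, of "of_nat :: nat \<Rightarrow> 'a"] by (simp add: algebra_simps)
      then show ?thesis
        using that assms(1) by (auto simp: A_entry_def C_nth algebra_simps)
    qed
    have "fps_deriv f $ n = of_nat (Suc n) * (V r x y (Suc n) / fact (Suc n))"
      by (simp add: f_def)
    also have "\<dots> = (\<Sum>j\<le>n. A_entry r x y (Suc n) (Suc j) * f $ j)"
      unfolding V_recurrence by (simp add: f_def)
    also have "\<dots> = (\<Sum>j\<le>n. C $ (n - j) * f $ j) +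
        (\<Sum>j\<le>n. if n + 1 = j + r then of_nat j * f $ j else 0)"
      by (subst sum.distrib[symmetric]) (auto intro!: sum.cong simp: entry ring_distribs)
    also have "(\<Sum>j\<le>n. C $ (n - j) * f $ j) = (f * C) $ n"
      unfolding fps_mult_nth atMost_atLeast0 by (simp add: mult.commute)
    also have "(\<Sum>j\<le>n. if n + 1 = j + r then of_nat j * f $ j else 0) = (fps_X ^ r * fps_deriv f) $ n"
    proof (cases "n + 1 < r")
      case True
      then show ?thesis by (auto simp: fps_X_power_mult_nth)
    next
      case False
      then have "(\<Sum>j\<le>n. if n + 1 = j + r then of_nat j * f $ j else 0) =
          (\<Sum>j\<le>n. if n + 1 - r = j then of_nat j * f $ j else 0)"
        by (intro sum.cong) auto
      also have "\<dots> = of_nat (n + 1 - r) * f $ (n + 1 - r)"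
        using assms(1) by (simp add: sum.delta)
      also have "\<dots> = (fps_X ^ r * fps_deriv f) $ n"
        \<comment> \<open>In the boundary case n + 1 = r the surviving index is 0, so its weight
          makes the left side vanish, matching a coefficient below degree r on the right.\<close>
        using False by (cases "n + 1 = r") (auto simp: fps_X_power_mult_nth Suc_diff_le)
      finally show ?thesis .
    qed
    finally show ?thesis by (simp add: mult.commute)
  qed
  then have "fps_deriv f = C * f + fps_X ^ r * fps_deriv f"
    by (simp add: fps_eq_iff)
  then show ?thesis
    unfolding C_def[symmetric] by (simp add: algebra_simps)
qed

text \<open>The binomial series B satisfies (1 + t) B' = a B. Substituting -u, which respects
  products because u has zero constant term, and applying the chain rule gives the claim with the
  denominator cleared.\<close>

lemma one_minus_power_deriv:
  fixes u :: "'a::field_char_0 fps"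
  assumes "u $ 0 = 0"
  shows "(1 - u) * fps_deriv (one_minus_power u a) =
    - (fps_const a * fps_deriv u * one_minus_power u a)"
proof -
  have u: "(- u) $ 0 = 0" using assms by simp
  have "(1 + fps_X) * fps_deriv (fps_binomial a) = fps_const a * fps_binomial a"
    by (subst fps_binomial_deriv) (simp add: fps_divide_unit mult_ac inverse_mult_eq_1')
  then have "((1 + fps_X) * fps_deriv (fps_binomial a)) oo (- u) =
      (fps_const a * fps_binomial a) oo (- u)" by simp
  then have "(1 - u) * (fps_deriv (fps_binomial a) oo (- u)) = fps_const a * one_minus_power u a"
    using u by (simp add: fps_compose_mult_distrib fps_compose_add_distrib one_minus_power_def)
  then show ?thesis
    unfolding one_minus_power_def fps_compose_deriv[OF u]
    by (simp add: mult_ac)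
qed

text \<open>The Wronskian f' g - f g' is killed by \<open>p\<close>, hence zero in an integral
  domain. So f / g has derivative zero, which in characteristic 0 makes it constant, and the
  constant terms force the value 1.\<close>

lemma fps_linear_ODE_unique:
  fixes f g p q :: "'a::field_char_0 fps"
  assumes "p * fps_deriv f = q * f" "p * fps_deriv g = q * g"
    and "p \<noteq> 0" "f $ 0 = g $ 0" "g $ 0 \<noteq> 0"
  shows "f = g"
proof -
  have "p * (fps_deriv f * g - f * fps_deriv g) = (p * fps_deriv f) * g - f * (p * fps_deriv g)"
    by (simp add: algebra_simps)
  also have "\<dots> = 0" unfolding assms(1,2) by (simp add: mult_ac)
  finally have "fps_deriv f * g - f * fps_deriv g = 0"
    using \<open>p \<noteq> 0\<close> by simp
  then have "fps_deriv (f / g) = 0"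
    using \<open>g $ 0 \<noteq> 0\<close> by (simp add: fps_divide_deriv)
  then have "f / g = fps_const ((f / g) $ 0)" by simp
  also have "\<dots> = 1" using assms(4,5) by (simp add: fps_divide_unit)
  finally show ?thesis
    using \<open>g $ 0 \<noteq> 0\<close> by (metis dvd_div_mult_self mult_1 fps_unit_dvd)
qed

theorem theorem2p3:
  fixes x y :: "'a::field_char_0" and r :: nat
  assumes "r \<ge> 2"
  shows "Abs_fps (\<lambda>n. V r x y n / fact n) =
    one_minus_power (fps_X ^ r) ((x - y) / of_nat r) * one_minus_power fps_X (- x)"
    (is "?f = ?P * ?Q")
proof (rule fps_linear_ODE_unique)
  let ?X = "fps_X :: 'a fps"
  \<comment> \<open>This is 1 - t times the coefficient in \<open>V_egf_ODE\<close>, with the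
    geometric sum telescoped. The extra factor also clears the denominator in the equation for
    \<open>?Q\<close>.\<close>
  let ?q = "fps_const x * (1 - ?X ^ (r - 1)) + fps_const y * ?X ^ (r - 1) * (1 - ?X)"
  have Xr: "?X ^ r = ?X * ?X ^ (r - 1)"
    using assms by (cases r) auto
  let ?S = "\<Sum>k<r - 1. ?X ^ k"
  have S: "(1 - ?X) * ?S = 1 - ?X ^ (r - 1)"
    by (rule one_diff_power_eq[symmetric])
  have "(1 - ?X) * ((1 - ?X ^ r) * fps_deriv ?f) =
      (fps_const x * ((1 - ?X) * ?S) + fps_const y * ?X ^ (r - 1) * (1 - ?X)) * ?f"
    unfolding V_egf_ODE[OF assms, of x y] by (simp only: ring_distribs mult_ac)
  then show "(1 - ?X) * (1 - ?X ^ r) * fps_deriv ?f = ?q * ?f"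
    unfolding S by (simp only: mult.assoc)
  \<comment> \<open>Differentiating t^r yields a factor r, which cancels the denominator of the
    exponent.\<close>
  have "(1 - ?X ^ r) * fps_deriv ?P =
      - (fps_const ((x - y) / of_nat r) * (fps_const (of_nat r) * ?X ^ (r - 1)) * ?P)"
    using assms by (subst one_minus_power_deriv) (simp_all add: fps_deriv_power)
  then have P: "(1 - ?X ^ r) * fps_deriv ?P = - ((fps_const x - fps_const y) * ?X ^ (r - 1) * ?P)"
    using assms by (simp flip: mult.assoc)
  have Q: "(1 - ?X) * fps_deriv ?Q = fps_const x * ?Q"
    by (subst one_minus_power_deriv) (simp_all flip: fps_const_neg)
  have "(1 - ?X) * (1 - ?X ^ r) * fps_deriv (?P * ?Q) =
      ((1 - ?X ^ r) * fps_deriv ?P) * ((1 - ?X) * ?Q) + ((1 - ?X) * fps_deriv ?Q) * ((1 - ?X ^ r) * ?P)"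
    by (simp only: fps_deriv_mult ring_distribs mult_ac add_ac)
  also have "\<dots> = ?q * (?P * ?Q)"
    \<comment> \<open>Writing t^r as t times t^(r-1) lets the t^r terms cancel: x (1 - t^r) - x
      t^(r-1) (1 - t) = x (1 - t^(r-1)).\<close>
    unfolding P Q unfolding Xr by (simp add: algebra_simps del: fps_const_sub)
  finally show "(1 - ?X) * (1 - ?X ^ r) * fps_deriv (?P * ?Q) = ?q * (?P * ?Q)" .
  have "((1 - ?X) * (1 - ?X ^ r)) $ 0 \<noteq> 0"
    using assms by (simp add: fps_X_power_nth)
  then show "(1 - ?X) * (1 - ?X ^ r) \<noteq> 0"
    by (metis fps_zero_nth)
  show "?f $ 0 = (?P * ?Q) $ 0" "(?P * ?Q) $ 0 \<noteq> 0"
    by (simp_all add: V_def one_minus_power_def)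
qed

end
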